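(* Let $F$ be a field, $A$ a finite-dimensional associative $F$-algebra with two-sided identity $1_A \neq 0_A$, and $H$ an $F$-subspace of $A$ of codimension one. Suppose that $H$ is not a two-sided ideal of $A$, and that it is not the case that both $|F| = 2$ and $A$ has a factor algebra (quotient by a two-sided ideal) isomorphic to $\mathbb{F}_2 \oplus \mathbb{F}_2 \oplus \mathbb{F}_2$. Then $H \cap U(A) \neq \emptyset$.
   Context: $U(A)$ denotes the group of units of $A$, i.e. the set of elements having a two-sided multiplicative inverse. $\mathbb{F}_2$ is the field with two elements. *)

theory Defs
  imports
    "HOL-Algebra.Algebra"
    "HOL-Algebra.Algebraic_Closure_Type"
    "HOL-Library.Cardinality"
    "HOL-Library.Z2"
begin

text \<open>
  The algebra is a unital ring type (where \<open>0 \<noteq> 1\<close> is part of the class \<open>ring_1\<close>) together with a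
  scalar multiplication by a field.  Finite dimensionality is stated as the existence of a finite
  spanning set, rather than by fixing a basis as in \<open>finite_dimensional_vector_space\<close>.
\<close>

locale finite_dimensional_algebra = vector_space scale
  for scale :: "'f::field \<Rightarrow> 'a::ring_1 \<Rightarrow> 'a" (infixr \<open>*s\<close> 75) +
  assumes scale_mult_left: "(c *s x) * y = c *s (x * y)"
    and scale_mult_right: "x * (c *s y) = c *s (x * y)"
    and finite_dimensional: "\<exists>B. finite B \<and> span B = UNIV"

text \<open>
  Ideals, factor rings and units are those of \<open>HOL-Algebra\<close>, applied to \<open>ring_of_type_algebra\<close>.
  As the algebra has a unit, ring ideals are closed under scalar multiplication, so the factor
  rings are exactly the factor algebras.  The next lemma drops the commutativity assumption from
  \<open>ring_from_type_algebra\<close>.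
\<close>

lemma ring_ring_of_type_algebra: "ring (ring_of_type_algebra :: 'a::ring_1 ring)"
proof -
  have "\<exists>y. x + y = 0" for x :: 'a
    using add.right_inverse by blast
  then show ?thesis
    unfolding ring_of_type_algebra_def using add.right_inverse
    by unfold_locales (auto simp: algebra_simps Units_def)
qed

definition F2 :: "bit ring"
  where "F2 = ring_of_type_algebra"

definition F2_cubed :: "(bit \<times> bit \<times> bit) ring"
  where "F2_cubed = RDirProd F2 (RDirProd F2 F2)"

text \<open>
  Only ring isomorphism is required here.  Over a field with two elements, the only case in which
  this is used, the scalars are \<open>0\<close> and \<open>1\<close>, so a ring isomorphism is an algebra isomorphism.
\<close>

definition has_factor_F2_cubed :: "'a::ring_1 itself \<Rightarrow> bool"
  where "has_factor_F2_cubed _ \<longleftrightarrow>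
    (\<exists>I. ideal I (ring_of_type_algebra :: 'a ring) \<and>
         (ring_of_type_algebra :: 'a ring) Quot I \<simeq> F2_cubed)"

end

theory Submission
  imports Defs
begin

text \<open>
  Suppose the linear functional \<open>f\<close> with kernel \<open>H\<close> has no zero among the units, and let \<open>I\<close> be the
  largest two-sided ideal inside \<open>H\<close>. If \<open>n\<close> is nilpotent, then \<open>u * (1 + t * n) * v\<close> is a unit for all
  scalars \<open>t\<close> and units \<open>u\<close>, \<open>v\<close>, which forces \<open>f (u * n * v) = 0\<close>; with Fitting's decomposition this
  improves to \<open>n \<in> I\<close>. Hence modulo \<open>I\<close> idempotents are central, every element is a unit times an
  idempotent, and units lift, so for an idempotent \<open>e\<close> and units \<open>u\<close>, \<open>v\<close> the glued element
  \<open>u * e + v * (1 - e)\<close> is a unit modulo \<open>I\<close> and \<open>f\<close> does not vanish there. Over a field with a scalar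
  other than \<open>0\<close> and \<open>1\<close> this makes every idempotent \<open>0\<close> or \<open>1\<close> modulo \<open>I\<close>, so \<open>H = I\<close>. Over the field
  with two elements it shows that every unit is \<open>1\<close> modulo \<open>I\<close>, so that \<open>A / I\<close> is Boolean; an element of
  \<open>H\<close> outside \<open>I\<close> then splits \<open>1\<close> into three nonzero orthogonal idempotents of \<open>A / I\<close>, and maximal ideals
  avoiding them give a surjection onto the cube of the field with two elements.
\<close>

section \<open>Units, two-sided ideals and nilpotents of a ring type\<close>

abbreviation nilp :: "'a::ring_1 \<Rightarrow> bool"
  where "nilp n \<equiv> \<exists>k. n ^ k = 0"

abbreviation type_units :: "'a::ring_1 set"
  where "type_units \<equiv> Units (ring_of_type_algebra :: 'a ring)"

abbreviation type_ideal :: "'a::ring_1 set \<Rightarrow> bool"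
  where "type_ideal I \<equiv> ideal I (ring_of_type_algebra :: 'a ring)"

lemma type_units_iff: "u \<in> type_units \<longleftrightarrow> (\<exists>v. u * v = 1 \<and> v * u = (1::'a::ring_1))"
  by (auto simp: Units_def ring_of_type_algebra_def)

lemma type_unitsI: "u * v = 1 \<Longrightarrow> v * u = 1 \<Longrightarrow> u \<in> type_units" for u v :: "'a::ring_1"
  by (auto simp: type_units_iff)

text \<open>Turns a product equation into a rewrite rule that applies inside right-nested
  products.\<close>

lemma mult_eq_left_assoc: "a * b = c \<Longrightarrow> a * (b * x) = c * x" for a b c x :: "'a::semigroup_mult"
  by (simp flip: mult.assoc)

lemma one_in_type_units: "(1 :: 'a::ring_1) \<in> type_units"
  by (rule type_unitsI[of _ 1]) auto

lemma mult_in_type_units: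
  fixes u v :: "'a::ring_1"
  assumes "u \<in> type_units" "v \<in> type_units"
  shows "u * v \<in> type_units"
proof -
  obtain u' v' where "u * u' = 1" "u' * u = 1" "v * v' = 1" "v' * v = 1"
    using assms unfolding type_units_iff by auto
  then show ?thesis
    by (intro type_unitsI[of _ "v' * u'"]) (metis mult.assoc mult_1_right)+
qed

lemma type_ideal_iff:
  fixes I :: "'a::ring_1 set"
  shows "type_ideal I \<longleftrightarrow> 0 \<in> I \<and> (\<forall>x\<in>I. \<forall>y\<in>I. x + y \<in> I) \<and> (\<forall>x\<in>I. \<forall>a. a * x \<in> I \<and> x * a \<in> I)"
    (is "?L \<longleftrightarrow> ?R")
proof
  assume ?L
  then interpret ideal I "ring_of_type_algebra :: 'a ring" .
  show ?R
    using additive_subgroup.zero_closed[OF is_additive_subgroup]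
      additive_subgroup.a_closed[OF is_additive_subgroup] I_l_closed I_r_closed by (auto simp: ring_of_type_algebra_def)
next
  assume R: ?R
  have "- x \<in> I" if "x \<in> I" for x
    using R that by (metis mult_minus1)
  moreover have "\<ominus>\<^bsub>ring_of_type_algebra\<^esub> x = - x" for x :: 'a
    using abelian_group.minus_equality[of "ring_of_type_algebra :: 'a ring" "-x" x]
      ring.is_abelian_group[OF ring_ring_of_type_algebra]
    by (auto simp: ring_of_type_algebra_def)
  ultimately have "subgroup I (add_monoid (ring_of_type_algebra :: 'a ring))"
    using R abelian_group.a_group[OF ring.is_abelian_group[OF ring_ring_of_type_algebra]]
    by (intro group.subgroupI) (auto simp: ring_of_type_algebra_def a_inv_def)
  then show ?L
    using R by (intro idealI ring_ring_of_type_algebra) (auto simp: ring_of_type_algebra_def)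
qed

lemma
  fixes I :: "'a::ring_1 set"
  assumes "type_ideal I"
  shows type_ideal_zero: "0 \<in> I"
    and type_ideal_add: "x \<in> I \<Longrightarrow> y \<in> I \<Longrightarrow> x + y \<in> I"
    and type_ideal_left: "x \<in> I \<Longrightarrow> a * x \<in> I"
    and type_ideal_right: "x \<in> I \<Longrightarrow> x * a \<in> I"
    and type_ideal_minus: "x \<in> I \<Longrightarrow> - x \<in> I"
    and type_ideal_diff: "x \<in> I \<Longrightarrow> y \<in> I \<Longrightarrow> x - y \<in> I"
proof -
  have R: "0 \<in> I \<and> (\<forall>x\<in>I. \<forall>y\<in>I. x + y \<in> I) \<and> (\<forall>x\<in>I. \<forall>a. a * x \<in> I \<and> x * a \<in> I)"
    using assms by (simp add: type_ideal_iff)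
  show m: "x \<in> I \<Longrightarrow> - x \<in> I" for x
    using R by (metis mult_minus1)
  show "x \<in> I \<Longrightarrow> y \<in> I \<Longrightarrow> x - y \<in> I"
    using R m by (metis diff_conv_add_uminus)
  show "0 \<in> I" "x \<in> I \<Longrightarrow> y \<in> I \<Longrightarrow> x + y \<in> I" "x \<in> I \<Longrightarrow> a * x \<in> I" "x \<in> I \<Longrightarrow> x * a \<in> I"
    using R by blast+
qed

lemma one_minus_nilp_unit:
  fixes n :: "'a::ring_1"
  assumes "nilp n"
  shows "1 - n \<in> type_units"
proof -
  \<comment> \<open>The \<open>y\<close> built by induction is the geometric sum
    \<open>1 + n + ... + n ^ (k - 1)\<close>.\<close>
  have "\<exists>y. (1 - n) * y = 1 - n ^ k \<and> y * (1 - n) = 1 - n ^ k" for k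
  proof (induction k)
    case 0
    show ?case by (rule exI[of _ 0]) simp
  next
    case (Suc k)
    then obtain y where y: "(1 - n) * y = 1 - n ^ k" "y * (1 - n) = 1 - n ^ k" by blast
    have "(1 - n) * (y + n ^ k) = 1 - n ^ Suc k" "(y + n ^ k) * (1 - n) = 1 - n ^ Suc k"
      unfolding distrib_left distrib_right y by (simp_all add: algebra_simps power_commutes)
    then show ?case by blast
  qed
  then show ?thesis
    using assms by (metis diff_zero type_unitsI)
qed

lemma nilp_uminus: "nilp n \<Longrightarrow> nilp (- n)" for n :: "'a::ring_1"
  by (metis mult_zero_right power_minus)

lemma square_zero_nilp: "n * n = 0 \<Longrightarrow> nilp n" for n :: "'a::ring_1"
  by (metis power2_eq_square)

lemma one_plus_nilp_unit: "nilp n \<Longrightarrow> 1 + n \<in> type_units" for n :: "'a::ring_1"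
  using one_minus_nilp_unit[of "- n"] nilp_uminus[of n] by simp

text \<open>Fitting's decomposition: \<open>y\<close> inverts \<open>a\<close> in the corner cut out by \<open>e\<close>, and the rest of \<open>a\<close> is
  nilpotent.\<close>

lemma fitting_decomposition:
  fixes a y :: "'a::ring_1"
  assumes ay: "a * y = y * a" and k: "a ^ Suc j = a ^ Suc (Suc j) * y"
  obtains e z where "e * e = e" "a * e = e * a" "e * y = y * e" "a * y * e = e"
    "nilp ((1 - e) * a)" "e = a * z" "e = z * a"
proof -
  define b c where "b = a ^ Suc j" and "c = y ^ Suc j"
  have ac: "a * c = c * a"
    unfolding c_def using ay by (metis power_commuting_commutes)
  have bc: "b * c = c * b" and ab: "a * b = b * a" and yc: "y * c = c * y"
    unfolding b_def using ac by (metis power_commuting_commutes, metis power_commutes, metis c_def power_commutes)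
  have yb: "y * b = b * y"
    unfolding b_def using ay by (metis power_commuting_commutes)
  have aby: "a * b * y = b"
    using k by (simp add: b_def)
  \<comment> \<open>This iterates \<open>aby\<close>. The case \<open>i = Suc j\<close> reads
    \<open>b * b * c = b\<close>, which makes \<open>b * c\<close> idempotent.\<close>
  have "a ^ i * b * y ^ i = b" for i
  proof (induction i)
    case (Suc i)
    have "a ^ Suc i * b * y ^ Suc i = a ^ i * (a * b * y) * y ^ i"
      by (metis mult.assoc power_Suc power_commutes)
    with Suc aby show ?case by simp
  qed (simp add: b_def)
  then have bbc: "b * b * c = b"
    by (metis b_def c_def)
  define e where "e = b * c"
  have ee: "e * e = e"
    unfolding e_def by (metis bbc bc mult.assoc)
  have ae: "a * e = e * a"
    unfolding e_def by (metis ab ac mult.assoc)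
  have ey: "e * y = y * e"
    unfolding e_def by (metis yb yc mult.assoc)
  have aye: "a * y * e = e"
    unfolding e_def by (metis aby yb mult.assoc)
  have be: "b * (1 - e) = 0"
    unfolding e_def using bbc by (simp add: algebra_simps flip: mult.assoc)
  have fi: "(a * (1 - e)) ^ i * (1 - e) = a ^ i * (1 - e)" for i
  proof (induction i)
    case (Suc i)
    have "(a * (1 - e)) ^ Suc i * (1 - e) = a * (1 - e) * (a ^ i * (1 - e))"
      using Suc by (simp add: mult.assoc)
    also have "\<dots> = a * ((1 - e) * a ^ i) * (1 - e)"
      by (simp only: mult.assoc)
    also have "(1 - e) * a ^ i = a ^ i * (1 - e)"
      using ae by (intro power_commuting_commutes[symmetric]) (simp add: algebra_simps)
    also have "a * (a ^ i * (1 - e)) * (1 - e) = a ^ Suc i * ((1 - e) * (1 - e))"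
      by (simp only: mult.assoc power_Suc)
    also have "(1 - e) * (1 - e) = 1 - e"
      using ee by (simp add: algebra_simps)
    finally show ?case .
  qed simp
  \<comment> \<open>The exponent is one above \<open>Suc j\<close>: the extra factor supplies the
    \<open>1 - e\<close> needed by \<open>fi\<close>, which leaves a product containing
    \<open>b * (1 - e) = 0\<close>.\<close>
  have "(a * (1 - e)) ^ Suc (Suc j) = (a * (1 - e)) ^ Suc j * (a * (1 - e))"
    by (simp only: power_Suc2)
  also have "a * (1 - e) = (1 - e) * a"
    using ae by (simp add: algebra_simps)
  also have "((1 - e) * a) ^ Suc j * ((1 - e) * a) = (a * (1 - e)) ^ Suc j * (1 - e) * a"
    using ae by (simp add: algebra_simps)
  also have "\<dots> = 0"
    using fi[of "Suc j"] be by (simp add: b_def)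
  finally have nil: "nilp ((1 - e) * a)"
    by blast
  have "e = a * (a ^ j * c)" "e = a ^ j * c * a"
    unfolding e_def b_def using ac by (simp_all add: mult.assoc power_commutes) (metis mult.assoc power_commutes)
  with ee ae ey aye nil show ?thesis
    using that by blast
qed

section \<open>Consequences of finite dimension: Fitting decompositions and hyperplanes as
  kernels\<close>

context finite_dimensional_algebra
begin

lemma obtain_finite_basis:
  obtains B where "finite_dimensional_vector_space scale B"
proof -
  obtain S where S: "finite S" "span S = UNIV"
    using finite_dimensional by blast
  then obtain B where B: "B \<subseteq> S" "independent B" "S \<subseteq> span B"
    using maximal_independent_subset[of S] by blast
  then have "span B = UNIV"
    using S by (metis span_minimal subspace_span top.extremum_uniqueI)
  then have "finite_dimensional_vector_space scale B"
    using B S by unfold_locales (auto intro: finite_subset)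
  then show ?thesis
    using that by blast
qed

text \<open>The spans \<open>W k\<close> of the powers from \<open>a ^ Suc k\<close> on decrease, so
  one of minimal dimension equals its successor. Then \<open>a ^ Suc k\<close> is a combination of
  higher powers, and factoring out \<open>a ^ Suc (Suc k)\<close> leaves a polynomial in
  \<open>a\<close>, which commutes with \<open>a\<close>.\<close>

lemma power_stabilizes:
  fixes a :: 'a
  obtains j y where "a * y = y * a" "a ^ Suc j = a ^ Suc (Suc j) * y"
proof -
  obtain B where "finite_dimensional_vector_space scale B"
    using obtain_finite_basis .
  then interpret fd: finite_dimensional_vector_space scale B .
  define W where "W k = span {a ^ i | i. i \<ge> Suc k}" for k
  define k where "k = (ARG_MIN (\<lambda>k. dim (W k)) k. True)"
  have "dim (W k) \<le> dim (W (Suc k))"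
    unfolding k_def by (rule arg_min_nat_le) simp
  moreover have "W (Suc k) \<subseteq> W k"
    unfolding W_def by (rule span_mono) auto
  ultimately have "W (Suc k) = W k"
    unfolding W_def by (intro fd.subspace_dim_equal) (auto simp: subspace_span)
  moreover have "a ^ Suc k \<in> W k"
    unfolding W_def by (rule span_base) (use le_refl in blast)
  moreover have "\<exists>y. a * y = y * a \<and> x = a ^ Suc (Suc k) * y" if "x \<in> W (Suc k)" for x
    using that unfolding W_def
  proof (induction rule: span_induct_alt)
    case base
    show ?case by (rule exI[of _ 0]) simp
  next
    case (step c x y)
    then obtain i v where x: "x = a ^ i" "Suc (Suc k) \<le> i" and v: "a * v = v * a" "y = a ^ Suc (Suc k) * v"
      by blast
    have "x = a ^ Suc (Suc k) * a ^ (i - Suc (Suc k))"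
      using x by (simp only: power_add[symmetric] le_add_diff_inverse)
    with v show ?case
      by (intro exI[of _ "c *s a ^ (i - Suc (Suc k)) + v"])
        (simp add: algebra_simps scale_mult_left scale_mult_right power_commutes)
  qed
  ultimately show ?thesis
    using that by metis
qed

lemma obtain_fitting:
  fixes a :: 'a
  obtains e y z where "e * e = e" "a * e = e * a" "a * y = y * a" "e * y = y * e" "a * y * e = e"
    "nilp ((1 - e) * a)" "e = a * z" "e = z * a"
  using power_stabilizes[of a] fitting_decomposition[of a] by metis

text \<open>For a fixed \<open>w\<close> outside \<open>H\<close>, the value \<open>f x\<close> is
  the coefficient of \<open>w\<close> in \<open>x\<close> modulo \<open>H\<close>. Uniqueness of
  this coefficient gives linearity and identifies the kernel.\<close>

lemma hyperplane_functional:
  assumes H: "subspace H" and codim: "dim (UNIV :: 'a set) = dim H + 1"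
  obtains f :: "'a \<Rightarrow> 'f" where "\<And>x y. f (x + y) = f x + f y" "\<And>c x. f (c *s x) = c * f x"
    "\<And>x. x \<in> H \<longleftrightarrow> f x = 0"
proof -
  obtain B where "finite_dimensional_vector_space scale B"
    using obtain_finite_basis .
  then interpret fd: finite_dimensional_vector_space scale B .
  obtain w where w: "w \<notin> H"
    using codim by (metis UNIV_eq_I add.commute less_add_one nat_less_le plus_1_eq_Suc)
  have spanH: "span H = H"
    using H by simp
  have w': "w \<notin> span H"
    using w by (simp only: spanH not_False_eq_True)
  have "dim (span (insert w H)) = dim (UNIV :: 'a set)"
    using codim fd.dim_insert[of w H] w' by simp
  then have "span (insert w H) = UNIV"
    by (intro fd.subspace_dim_equal) (auto simp: subspace_span)
  then have "\<exists>c. x - c *s w \<in> H" for x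
    using span_breakdown_eq[of x w H] spanH by auto
  then obtain f where f: "\<And>x. x - f x *s w \<in> H"
    by metis
  have uniq: "f x = c" if "x - c *s w \<in> H" for x c
  proof (rule ccontr)
    assume "f x \<noteq> c"
    have "(x - c *s w) - (x - f x *s w) \<in> H"
      using that f H subspace_diff by blast
    then have "(f x - c) *s w \<in> H"
      by (simp add: algebra_simps)
    then have "inverse (f x - c) *s (f x - c) *s w \<in> H"
      using H subspace_scale by blast
    with \<open>f x \<noteq> c\<close> w show False by simp
  qed
  show ?thesis
  proof (rule that[of f])
    fix x y c
    have "(x - f x *s w) + (y - f y *s w) \<in> H"
      using f H subspace_add by blast
    then show "f (x + y) = f x + f y"
      by (intro uniq) (simp add: algebra_simps)
    have "c *s (x - f x *s w) \<in> H"
      using f H subspace_scale by blast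
    then show "f (c *s x) = c * f x"
      by (intro uniq) (simp add: algebra_simps)
    show "x \<in> H \<longleftrightarrow> f x = 0"
      using f[of x] uniq[of x 0] by auto
  qed
qed

end

section \<open>Functionals without zeros among the units\<close>

locale functional_nonzero_on_units = finite_dimensional_algebra scale
  for scale :: "'f::field \<Rightarrow> 'a::ring_1 \<Rightarrow> 'a" (infixr \<open>*s\<close> 75) +
  fixes f :: "'a \<Rightarrow> 'f"
  assumes f_add: "f (x + y) = f x + f y"
    and f_scale: "f (c *s x) = c * f x"
    and f_unit: "u \<in> type_units \<Longrightarrow> f u \<noteq> 0"
begin

lemma f_zero [simp]: "f 0 = 0"
  using f_scale[of 0 0] by simp

lemma f_minus: "f (- x) = - f x"
  using f_add[of x "- x"] by (simp add: eq_neg_iff_add_eq_0 add.commute)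

lemma f_diff: "f (x - y) = f x - f y"
  using f_add[of x "- y"] f_minus by simp

text \<open>\<open>core\<close> is the largest two-sided ideal on which \<open>f\<close> vanishes. The weaker \<open>unit_core\<close> is stable
  only under units, hence under nilpotents \<open>n = (1 + n) - 1\<close>; over the field with two elements
  the units need not span the algebra, and passing from one to the other is the crux.\<close>

definition unit_core :: "'a set"
  where "unit_core = {x. \<forall>u\<in>type_units. \<forall>v\<in>type_units. f (u * x * v) = 0}"

definition core :: "'a set"
  where "core = {x. \<forall>a b. f (a * x * b) = 0}"

section \<open>Nilpotents: from \<open>unit_core\<close> to \<open>core\<close>\<close>

lemma unit_core_add: "x \<in> unit_core \<Longrightarrow> y \<in> unit_core \<Longrightarrow> x + y \<in> unit_core"
  by (simp add: unit_core_def distrib_left distrib_right f_add)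

lemma unit_core_diff: "x \<in> unit_core \<Longrightarrow> y \<in> unit_core \<Longrightarrow> x - y \<in> unit_core"
  by (simp add: unit_core_def right_diff_distrib left_diff_distrib f_diff)

lemma unit_core_unit_left: "x \<in> unit_core \<Longrightarrow> w \<in> type_units \<Longrightarrow> w * x \<in> unit_core"
  unfolding unit_core_def using mult_in_type_units[of _ w] by (simp add: mult.assoc[symmetric])

lemma unit_core_unit_right: "x \<in> unit_core \<Longrightarrow> w \<in> type_units \<Longrightarrow> x * w \<in> unit_core"
  unfolding unit_core_def using mult_in_type_units[of w] by (simp add: mult.assoc)

lemma nilp_in_unit_core:
  assumes n: "nilp n"
  shows "n \<in> unit_core"
proof -
  have "f (u * n * v) = 0" if u: "u \<in> type_units" and v: "v \<in> type_units" for u v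
  proof (rule ccontr)
    assume nz: "f (u * n * v) \<noteq> 0"
    \<comment> \<open>The root of \<open>t \<mapsto> f (u * (1 + t *s n) * v)\<close>, an affine
      function of \<open>t\<close> with slope \<open>f (u * n * v)\<close>.\<close>
    define t where "t = - f (u * v) / f (u * n * v)"
    have "(t *s n) ^ k = t ^ k *s n ^ k" for k
      by (induction k) (simp_all add: scale_mult_left scale_mult_right mult.assoc)
    then have "nilp (t *s n)"
      using n by (metis scale_zero_right)
    then have "u * (1 + t *s n) * v \<in> type_units"
      using u v one_plus_nilp_unit mult_in_type_units by blast
    then have "f (u * (1 + t *s n) * v) \<noteq> 0"
      by (rule f_unit)
    moreover have "f (u * (1 + t *s n) * v) = f (u * v) + t * f (u * n * v)"
      by (simp add: distrib_left distrib_right f_add scale_mult_left scale_mult_right f_scale)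
    ultimately show False
      using nz by (simp add: t_def)
  qed
  then show ?thesis
    by (simp add: unit_core_def)
qed

lemma unit_core_nilp_left: "x \<in> unit_core \<Longrightarrow> nilp n \<Longrightarrow> n * x \<in> unit_core"
  using unit_core_diff[OF unit_core_unit_left[OF _ one_plus_nilp_unit], of x n x]
  by (simp add: distrib_right)

lemma unit_core_nilp_right: "x \<in> unit_core \<Longrightarrow> nilp n \<Longrightarrow> x * n \<in> unit_core"
  using unit_core_diff[OF unit_core_unit_right[OF _ one_plus_nilp_unit], of x n x]
  by (simp add: distrib_left)

lemma idempotent_compl_zero:
  fixes e :: 'a
  assumes "e * e = e"
  shows "(1 - e) * e = 0" "e * (1 - e) = 0" "(1 - e) * (1 - e) = 1 - e"
  using assms by (simp_all add: algebra_simps)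

lemma peirce_nilp:
  fixes e x :: 'a
  assumes "e * e = e"
  shows "nilp (e * x * (1 - e))" "nilp ((1 - e) * x * e)"
proof -
  have "e * x * (1 - e) * (e * x * (1 - e)) = e * x * ((1 - e) * e) * x * (1 - e)"
    by (simp only: mult.assoc)
  then show "nilp (e * x * (1 - e))"
    using idempotent_compl_zero[OF assms] by (intro square_zero_nilp) simp
  have "(1 - e) * x * e * ((1 - e) * x * e) = (1 - e) * x * (e * (1 - e)) * x * e"
    by (simp only: mult.assoc)
  then show "nilp ((1 - e) * x * e)"
    using idempotent_compl_zero[OF assms] by (intro square_zero_nilp) simp
qed

text \<open>Modulo the ideal \<open>h A (1 - h) A h\<close> of the corner \<open>h A h\<close>, the compression of \<open>n\<close> is
  nilpotent, so if it is also a unit of the corner, that ideal is the whole corner.\<close>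

lemma corner_in_unit_core:
  assumes h: "h * h = h" and n: "nilp n" and c: "h * n * h = c" and cy: "c * y = h"
  shows "h * x * h \<in> unit_core"
proof -
  \<comment> \<open>\<open>unit_core\<close> is not known to be an ideal, so \<open>B\<close>
    collects the elements whose two-sided corner multiples all lie in it.\<close>
  define B where "B = {z. \<forall>p q. h * p * h * z * (h * q * h) \<in> unit_core}"
  have B_add: "z + z' \<in> B" if "z \<in> B" "z' \<in> B" for z z'
    using that unit_core_add by (simp add: B_def distrib_left distrib_right)
  have ch: "c * h = c" "h * c = c"
    using c h by (metis mult.assoc)+
  have B_c: "z * c \<in> B" if "z \<in> B" for z
  proof -
    have "h * p * h * (z * c) * (h * q * h) \<in> unit_core" for p q
    proof -
      have "h * p * h * (z * c) * (h * q * h) = h * p * h * z * (h * (c * h * q) * h)"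
        by (simp add: mult.assoc ch[THEN mult_eq_left_assoc])
      then show ?thesis
        using that unfolding B_def by simp
    qed
    then show ?thesis
      by (simp add: B_def)
  qed
  have B_peirce: "h * p * (1 - h) * q * h \<in> B" for p q
  proof -
    have "h * r * h * (h * p * (1 - h) * q * h) * (h * s * h) \<in> unit_core" for r s
    proof -
      \<comment> \<open>Since \<open>1 - h\<close> is its own square, the product splits into two
        off-diagonal Peirce elements. Both are nilpotent, and left multiplication by a nilpotent
        preserves \<open>unit_core\<close>.\<close>
      have "h * (r * h * p) * (1 - h) * ((1 - h) * (q * h * s) * h) \<in> unit_core"
        using h by (intro unit_core_nilp_left nilp_in_unit_core peirce_nilp)
      moreover have "h * (r * h * p) * (1 - h) * ((1 - h) * (q * h * s) * h)
          = h * r * h * p * ((1 - h) * (1 - h)) * q * h * s * h"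
        by (simp only: mult.assoc)
      moreover have "h * r * h * p * ((1 - h) * (1 - h)) * q * h * s * h
          = h * r * (h * h) * p * (1 - h) * q * (h * h) * s * h"
        using idempotent_compl_zero(3)[OF h] h by (simp only:)
      moreover have "h * r * (h * h) * p * (1 - h) * q * (h * h) * s * h
          = h * r * h * (h * p * (1 - h) * q * h) * (h * s * h)"
        by (simp add: mult.assoc h h[THEN mult_eq_left_assoc])
      ultimately show ?thesis by simp
    qed
    then show ?thesis
      by (simp add: B_def)
  qed
  \<comment> \<open>Compression is multiplicative on powers of \<open>n\<close> up to
    \<open>B\<close>: inserting \<open>h + (1 - h)\<close> before the last factor gives an error
    covered by \<open>B_peirce\<close>.\<close>
  have "h * n ^ j * h - h * c ^ j \<in> B" for j
  proof (induction j)
    case 0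
    have "0 \<in> unit_core" by (simp add: unit_core_def)
    then show ?case using h by (simp add: B_def)
  next
    case (Suc j)
    have "h * n ^ Suc j * h = h * n ^ j * n * h"
      by (simp only: power_Suc2 mult.assoc)
    also have "\<dots> = h * n ^ j * h * (h * n * h) + h * n ^ j * (1 - h) * n * h"
      by (simp add: algebra_simps h[THEN mult_eq_left_assoc])
    finally have "h * n ^ Suc j * h - h * c ^ Suc j
        = (h * n ^ j * h - h * c ^ j) * c + h * n ^ j * (1 - h) * n * h"
      using c by (simp add: algebra_simps power_commutes)
    then show ?case
      using Suc B_c B_add B_peirce by metis
  qed
  moreover obtain k where "n ^ k = 0"
    using n by blast
  ultimately have "- (h * c ^ k) \<in> B"
    by (metis diff_0 mult_zero_left mult_zero_right)
  \<comment> \<open>The right factor is chosen so that \<open>y ^ k\<close> cancels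
    \<open>c ^ k\<close> in the corner and the two signs cancel, leaving
    \<open>h * x * h\<close>.\<close>
  then have "h * 1 * h * - (h * c ^ k) * (h * - (y ^ k * x) * h) \<in> unit_core"
    unfolding B_def by blast
  moreover have chk: "h * c ^ i = c ^ i * h" for i
    using ch by (intro power_commuting_commutes[symmetric]) simp
  have "h * c ^ i * y ^ i = h" for i
  proof (induction i)
    case (Suc i)
    have "h * c ^ Suc i * y ^ Suc i = h * c ^ i * (c * y) * y ^ i"
      by (simp only: power_Suc2[of c] power_Suc[of y] mult.assoc)
    also have "\<dots> = h * c ^ i * y ^ i"
      using cy chk h by (metis mult.assoc)
    finally show ?case using Suc by simp
  qed (use h in simp)
  then have "h * c ^ k * y ^ k = h" .
  moreover have "h * 1 * h * - (h * c ^ k) * (h * - (y ^ k * x) * h) = h * c ^ k * y ^ k * x * h"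
  proof -
    have "h * 1 * h * - (h * c ^ k) * (h * - (y ^ k * x) * h) = (h * h) * (h * c ^ k * h) * y ^ k * x * h"
      by (simp add: mult.assoc)
    also have "h * c ^ k * h = h * c ^ k"
      using chk h by (metis mult.assoc)
    finally show ?thesis using h by (simp flip: mult.assoc)
  qed
  ultimately show ?thesis
    by simp
qed

text \<open>Fitting for \<open>a = g * n * g\<close> gives \<open>h\<close> and the nilpotent rest
  \<open>m\<close>. As \<open>h\<close> lies in the corner of \<open>g\<close>,
  \<open>h * n * h = a * h\<close>, which is invertible in the corner of \<open>h\<close>, so
  \<open>corner_in_unit_core\<close> applies.\<close>

lemma compression_decomposition:
  assumes g: "g * g = g" and n: "nilp n"
  obtains h m where "h * h = h" "nilp m" "g * n * g = h * (g * n * g) * h + m"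
    "\<And>x. h * x * h \<in> unit_core"
proof -
  define a where "a = g * n * g"
  obtain h y z where h: "h * h = h" "a * h = h * a" "a * y = y * a" "h * y = y * h" "a * y * h = h"
    "nilp ((1 - h) * a)" "h = a * z" "h = z * a"
    using obtain_fitting[of a] by metis
  have ga: "g * a = a" "a * g = a"
    unfolding a_def using g by (metis mult.assoc)+
  have gh: "g * h = h" "h * g = h"
    using ga h(7,8) by (metis mult.assoc)+
  have "h * n * h = h * a * h"
    unfolding a_def using gh by (metis mult.assoc)
  then have "h * n * h = a * h"
    using h(1,2) by (metis mult.assoc)
  moreover have "a * h * y = h"
    using h by (metis mult.assoc)
  ultimately have "h * x * h \<in> unit_core" for x
    using corner_in_unit_core h(1) n by blast
  moreover have "a = h * a * h + (1 - h) * a"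
    using h(1) by (simp add: algebra_simps h(2) mult_eq_left_assoc)
  ultimately show ?thesis
    using that[of h "(1 - h) * a"] h unfolding a_def by blast
qed

lemma compression_in_unit_core:
  assumes "g * g = g" "nilp n"
  shows "g * n * g \<in> unit_core"
  using compression_decomposition[OF assms] nilp_in_unit_core unit_core_add by metis

lemma nilp_idempotent_right:
  assumes g: "g * g = g" and n: "nilp n"
  shows "n * g \<in> unit_core"
proof -
  have "n * g = g * n * g + (1 - g) * n * g"
    by (simp add: algebra_simps)
  then show ?thesis
    using compression_in_unit_core[OF g n] nilp_in_unit_core[OF peirce_nilp(2)[OF g]] unit_core_add
    by metis
qed

text \<open>The off-diagonal part \<open>e * n * (1 - e)\<close> is nilpotent, so only
  \<open>e * n * e * g\<close> needs work. Its summand \<open>s * g\<close> splits into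
  \<open>s * g * h\<close>, in the corner of \<open>h\<close>, and the nilpotent
  \<open>s * g * (1 - h)\<close>; \<open>m * g\<close> has a nilpotent left factor.\<close>

lemma idempotent_nilp_idempotent:
  assumes e: "e * e = e" and g: "g * g = g" and n: "nilp n"
  shows "e * n * g \<in> unit_core"
proof -
  obtain h m where hm: "h * h = h" "nilp m" "e * n * e = h * (e * n * e) * h + m"
    "\<And>x. h * x * h \<in> unit_core"
    using compression_decomposition[OF e n] by metis
  define s where "s = h * (e * n * e) * h"
  have "e * n * g = e * n * (1 - e) * g + e * n * e * g"
    by (simp add: algebra_simps)
  also have "e * n * e * g = (s + m) * g"
    using hm(3) by (simp add: s_def)
  also have "\<dots> = s * g * h + s * g * (1 - h) + m * g"
    by (simp add: algebra_simps)
  finally have eq: "e * n * g = e * n * (1 - e) * g + (s * g * h + s * g * (1 - h) + m * g)" .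
  have "s * g * h \<in> unit_core"
    unfolding s_def using hm(4)[of "e * n * e * h * g"] by (simp only: mult.assoc)
  moreover have "s * g * (1 - h) \<in> unit_core"
    unfolding s_def using nilp_in_unit_core[OF peirce_nilp(1)[OF hm(1)], of "e * n * e * h * g"]
    by (simp only: mult.assoc)
  moreover have "m * g \<in> unit_core"
    using nilp_idempotent_right[OF g hm(2)] .
  moreover have "e * n * (1 - e) * g \<in> unit_core"
    using nilp_idempotent_right[OF g peirce_nilp(1)[OF e]] .
  ultimately show ?thesis
    unfolding eq by (intro unit_core_add)
qed

text \<open>The unit agrees with \<open>a\<close> on the component where \<open>a\<close> is
  invertible and is the identity on the complement.\<close>

lemma fitting_unit:
  fixes a :: 'a
  obtains u e where "u \<in> type_units" "e * e = e" "u * e = e * u" "nilp (a - u * e)"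
proof -
  obtain e y z where e: "e * e = e" "a * e = e * a" "a * y = y * a" "e * y = y * e" "a * y * e = e"
    "nilp ((1 - e) * a)"
    using obtain_fitting[of a] by metis
  define u where "u = a * e + (1 - e)"
  have aeye: "a * e * (y * e) = e"
    using e by (metis mult.assoc)
  have yeae: "y * e * (a * e) = e"
    using e by (metis mult.assoc)
  have z: "a * e * (1 - e) = 0" "(1 - e) * (y * e) = 0" "y * e * (1 - e) = 0" "(1 - e) * (a * e) = 0"
    using idempotent_compl_zero[OF e(1)] e(2,4) by (metis mult.assoc mult_zero_right mult_zero_left)+
  have "u \<in> type_units"
  proof (rule type_unitsI)
    show "u * (y * e + (1 - e)) = 1"
      unfolding u_def distrib_left distrib_right
      using idempotent_compl_zero(3)[OF e(1)] aeye z by simp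
    show "(y * e + (1 - e)) * u = 1"
      unfolding u_def distrib_left distrib_right
      using idempotent_compl_zero(3)[OF e(1)] yeae z by simp
  qed
  moreover have "u * e = a * e"
    unfolding u_def using e(1) by (simp add: algebra_simps)
  moreover have "e * u = a * e"
    unfolding u_def using e(1) by (simp add: algebra_simps e(2) mult_eq_left_assoc)
  moreover have "a - u * e = (1 - e) * a"
    using \<open>u * e = a * e\<close> e(2) by (simp add: algebra_simps)
  ultimately show ?thesis
    using that[of u e] e by metis
qed

text \<open>By Fitting, every element is a unit times an idempotent plus a nilpotent, so two-sided multiples
  of \<open>n\<close> reduce to \<open>e * n * g\<close> with idempotents \<open>e\<close> and \<open>g\<close>.\<close>

lemma nilp_in_core:
  assumes n: "nilp n"
  shows "n \<in> core"
proof -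
  have "f (a * n * b) = 0" for a b
  proof -
    obtain u e where a: "u \<in> type_units" "e * e = e" "nilp (a - u * e)"
      using fitting_unit[of a] by metis
    obtain v g where b: "v \<in> type_units" "g * g = g" "v * g = g * v" "nilp (b - v * g)"
      using fitting_unit[of b] by metis
    define m where "m = a - u * e"
    define m' where "m' = b - v * g"
    have "a * n * b = (u * e + m) * n * (g * v + m')"
      using b(3) by (simp add: m_def m'_def)
    \<comment> \<open>The factors \<open>1\<close> are idempotents too, so
      \<open>idempotent_nilp_idempotent\<close> also covers the terms with a nilpotent on one
      side.\<close>
    also have "\<dots> = u * (e * n * g) * v + u * (e * n * 1) * m' + m * (1 * n * g) * v + m * n * m'"
      by (simp add: algebra_simps)
    finally have eq: "a * n * b
      = u * (e * n * g) * v + u * (e * n * 1) * m' + m * (1 * n * g) * v + m * n * m'" .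
    have m: "nilp m" "nilp m'"
      using a b by (simp_all add: m_def m'_def)
    have "e * n * g \<in> unit_core" "e * n * 1 \<in> unit_core" "1 * n * g \<in> unit_core" "n \<in> unit_core"
      by (rule idempotent_nilp_idempotent nilp_in_unit_core; use a b n in simp)+
    then have "a * n * b \<in> unit_core"
      unfolding eq using a(1) b(1) m
      by (metis unit_core_add unit_core_unit_left unit_core_unit_right unit_core_nilp_left
          unit_core_nilp_right)
    then have "f (1 * (a * n * b) * 1) = 0"
      unfolding unit_core_def using one_in_type_units by blast
    then show ?thesis by simp
  qed
  then show ?thesis by (simp add: core_def)
qed

section \<open>The quotient by \<open>core\<close>: central idempotents, lifting and gluing of
  units\<close>

lemma core_ideal: "type_ideal core"
proof -
  have "f (a * (c * x) * b) = 0" "f (a * (x * c) * b) = 0" if "x \<in> core" for a b c x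
  proof -
    have "f (a * c * x * b) = 0" "f (a * x * (c * b)) = 0"
      using that by (simp_all add: core_def)
    then show "f (a * (c * x) * b) = 0" "f (a * (x * c) * b) = 0"
      by (simp_all only: mult.assoc)
  qed
  then show ?thesis
    unfolding type_ideal_iff by (simp add: core_def distrib_left distrib_right f_add)
qed

lemmas core_add = type_ideal_add[OF core_ideal]
  and core_left = type_ideal_left[OF core_ideal]
  and core_right = type_ideal_right[OF core_ideal]
  and core_minus = type_ideal_minus[OF core_ideal]
  and core_diff = type_ideal_diff[OF core_ideal]

lemma f_core: "x \<in> core \<Longrightarrow> f x = 0"
  using spec[OF spec[of "\<lambda>a. \<forall>b. f (a * x * b) = 0" 1], of 1] by (simp add: core_def)

lemma f_cong: "x - y \<in> core \<Longrightarrow> f x = f y"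
  using f_core[of "x - y"] f_diff[of x y] by simp

text \<open>The commutator is a difference of two off-diagonal Peirce elements, both
  nilpotent.\<close>

lemma idempotent_central:
  assumes "e * e = e"
  shows "e * x - x * e \<in> core"
proof -
  have "e * x - x * e = e * x * (1 - e) - (1 - e) * x * e"
    by (simp add: algebra_simps)
  then show ?thesis
    using nilp_in_core[OF peirce_nilp(1)[OF assms]] nilp_in_core[OF peirce_nilp(2)[OF assms]]
      core_diff by metis
qed

lemma unit_idempotent_mod_core:
  obtains u e where "u \<in> type_units" "e * e = e" "a - u * e \<in> core"
  using fitting_unit[of a] nilp_in_core by metis

text \<open>Modulo \<open>core\<close>, \<open>w\<close> is \<open>u * e\<close> with
  \<open>u\<close> a unit commuting with \<open>e\<close>. Then \<open>1 - e\<close> is congruent to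
  \<open>(1 - e) * w * w'\<close>, hence to \<open>0\<close>, so \<open>w\<close> is congruent to
  \<open>u\<close>.\<close>

lemma unit_lift:
  assumes w: "w * w' - 1 \<in> core"
  obtains v where "v \<in> type_units" "w - v \<in> core"
proof -
  obtain u e where u: "u \<in> type_units" "e * e = e" "u * e = e * u" "nilp (w - u * e)"
    using fitting_unit[of w] by metis
  have n: "w - u * e \<in> core"
    using u nilp_in_core by blast
  have "(1 - e) * (w - u * e) * w' - (1 - e) * (w * w' - 1) \<in> core"
    by (rule core_diff[OF core_right[OF core_left[OF n]] core_left[OF w]])
  moreover have "(1 - e) * (w - u * e) * w' - (1 - e) * (w * w' - 1) = 1 - e"
  proof -
    have "(1 - e) * (u * e) = 0"
      unfolding u(3) using idempotent_compl_zero(1)[OF u(2)] by (metis mult.assoc mult_zero_left)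
    then have "(1 - e) * (w - u * e) = (1 - e) * w"
      by (simp add: right_diff_distrib)
    then show ?thesis
      by (simp add: algebra_simps)
  qed
  ultimately have "u * (1 - e) \<in> core"
    using core_left by metis
  then have "(w - u * e) - u * (1 - e) \<in> core"
    using n core_diff by blast
  then have "w - u \<in> core"
    by (simp add: algebra_simps)
  then show ?thesis
    using that u by blast
qed

text \<open>With \<open>e\<close> central modulo \<open>core\<close>, gluing the inverses in the
  same way gives an inverse modulo \<open>core\<close>, and \<open>unit_lift\<close>
  finishes.\<close>

lemma glue_units:
  assumes u: "u \<in> type_units" and v: "v \<in> type_units" and e: "e * e = e"
  obtains w where "w \<in> type_units" "u * e + v * (1 - e) - w \<in> core"
proof -
  obtain u' v' where u': "u * u' = 1" and v': "v * v' = 1"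
    using u v type_units_iff by blast
  have "(u * e + v * (1 - e)) * (u' * e + v' * (1 - e)) - 1
      = u * (e * u' - u' * e) * e + u * (e * v' - v' * e) * (1 - e)
        - v * (e * u' - u' * e) * e - v * (e * v' - v' * e) * (1 - e)
        + (u * u' * (e * e) - e) + (v * v' * ((1 - e) * (1 - e)) - (1 - e))
        + (u * v' * (e * (1 - e)) + v * u' * ((1 - e) * e))"
    by (simp add: algebra_simps)
  also have "\<dots> = u * (e * u' - u' * e) * e + u * (e * v' - v' * e) * (1 - e)
        - v * (e * u' - u' * e) * e - v * (e * v' - v' * e) * (1 - e)"
    by (simp add: u' v' e idempotent_compl_zero[OF e])
  also have "\<dots> \<in> core"
    by (intro core_diff core_add core_right core_left idempotent_central[OF e])
  finally show ?thesis
    using unit_lift that by metis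
qed

lemma f_glue:
  assumes "u \<in> type_units" "v \<in> type_units" "e * e = e"
  shows "f (u * e) + f (v * (1 - e)) \<noteq> 0"
proof -
  obtain w where "w \<in> type_units" "u * e + v * (1 - e) - w \<in> core"
    using glue_units[OF assms] .
  then show ?thesis
    using f_unit[of w] f_cong f_add by metis
qed

end

section \<open>Boolean quotients\<close>

text \<open>Zorn gives \<open>P\<close> maximal among the ideals containing \<open>I\<close> and
  avoiding \<open>g\<close>. If \<open>P\<close> contained neither \<open>a\<close> nor
  \<open>1 - a\<close>, then modulo \<open>P\<close> the element \<open>g\<close> would be a
  multiple of both, so \<open>g = g * g\<close> would be a multiple of
  \<open>a * (1 - a) = 0\<close>.\<close>

lemma boolean_prime_ideal:
  fixes I :: "'a::ring_1 set"
  assumes I: "type_ideal I" and comm: "\<And>x y. x * y - y * x \<in> I"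
    and bool: "\<And>x. x * x - x \<in> I" and g: "g \<notin> I"
  obtains P where "type_ideal P" "I \<subseteq> P" "g \<notin> P" "\<And>a. a \<in> P \<or> 1 - a \<in> P"
proof -
  define \<A> where "\<A> = {P. type_ideal P \<and> I \<subseteq> P \<and> g \<notin> P}"
  have "\<Union>C \<in> \<A>" if C: "C \<noteq> {}" "subset.chain \<A> C" for C
  proof -
    have ideals: "type_ideal P" "I \<subseteq> P" "g \<notin> P" if "P \<in> C" for P
      using C that by (auto simp: subset.chain_def \<A>_def)
    have "x + y \<in> \<Union>C" if "x \<in> \<Union>C" "y \<in> \<Union>C" for x y
    proof -
      obtain P Q where PQ: "P \<in> C" "Q \<in> C" "x \<in> P" "y \<in> Q"
        using \<open>x \<in> \<Union>C\<close> \<open>y \<in> \<Union>C\<close> by blast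
      then have "P \<subseteq> Q \<or> Q \<subseteq> P"
        using C(2) unfolding subset.chain_def by blast
      then show ?thesis
        using PQ ideals(1) type_ideal_add by blast
    qed
    moreover have "0 \<in> \<Union>C"
      using C(1) ideals(1) type_ideal_zero by blast
    moreover have "a * x \<in> \<Union>C" "x * a \<in> \<Union>C" if "x \<in> \<Union>C" for x a
      using that ideals(1) type_ideal_left type_ideal_right by blast+
    ultimately have "type_ideal (\<Union>C)"
      unfolding type_ideal_iff by blast
    moreover have "I \<subseteq> \<Union>C"
      using C(1) ideals(2) by blast
    ultimately show ?thesis
      using ideals(3) by (auto simp: \<A>_def)
  qed
  moreover have "\<A> \<noteq> {}"
    using I g by (auto simp: \<A>_def)
  ultimately obtain P where P: "P \<in> \<A>" and max: "\<And>J. J \<in> \<A> \<Longrightarrow> P \<subseteq> J \<Longrightarrow> J = P"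
    using subset_Zorn_nonempty[of \<A>] by blast
  have PI: "type_ideal P" "I \<subseteq> P" "g \<notin> P"
    using P by (auto simp: \<A>_def)
  note P_add = type_ideal_add[OF PI(1)] and P_left = type_ideal_left[OF PI(1)]
    and P_right = type_ideal_right[OF PI(1)] and P_diff = type_ideal_diff[OF PI(1)]
  have ext: "\<exists>p\<in>P. \<exists>x. g = p + a * x" if "a \<notin> P" for a
  proof (rule ccontr)
    assume neg: "\<not> ?thesis"
    \<comment> \<open>The ideal generated by \<open>P\<close> and \<open>a\<close>; right multiples
      of \<open>a\<close> suffice because commutators lie in \<open>I\<close>, hence in
      \<open>P\<close>.\<close>
    define Q where "Q = {p + a * x | p x. p \<in> P}"
    have "0 \<in> Q"
      unfolding Q_def using type_ideal_zero[OF PI(1)] by (auto intro!: exI[of _ 0])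
    moreover have "s + t \<in> Q" if "s \<in> Q" "t \<in> Q" for s t
    proof -
      obtain p x q y where "s = p + a * x" "p \<in> P" "t = q + a * y" "q \<in> P"
        using \<open>s \<in> Q\<close> \<open>t \<in> Q\<close> unfolding Q_def by blast
      then have "s + t = (p + q) + a * (x + y)" "p + q \<in> P"
        using P_add by (auto simp: algebra_simps)
      then show ?thesis unfolding Q_def by blast
    qed
    moreover have "r * s \<in> Q \<and> s * r \<in> Q" if "s \<in> Q" for r s
    proof -
      obtain p x where s: "s = p + a * x" "p \<in> P"
        using \<open>s \<in> Q\<close> unfolding Q_def by blast
      have "r * s = (r * p + (r * a - a * r) * x) + a * (r * x)"
        using s by (simp add: algebra_simps)
      moreover have "r * p + (r * a - a * r) * x \<in> P"
        using s comm[of r a] PI(2) by (intro P_add P_left P_right) auto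
      moreover have "s * r = p * r + a * (x * r)" "p * r \<in> P"
        using s P_right by (auto simp: algebra_simps)
      ultimately show ?thesis unfolding Q_def by blast
    qed
    ultimately have "type_ideal Q"
      unfolding type_ideal_iff by blast
    moreover have "P \<subseteq> Q"
    proof
      fix p assume "p \<in> P"
      then have "p = p + a * 0" "p \<in> P" by auto
      then show "p \<in> Q" unfolding Q_def by blast
    qed
    moreover have "g \<notin> Q"
      using neg unfolding Q_def by blast
    ultimately have "Q = P"
      using max PI(2) by (auto simp: \<A>_def)
    moreover have "0 + a * 1 \<in> Q"
      using type_ideal_zero[OF PI(1)] unfolding Q_def by blast
    ultimately show False
      using that by simp
  qed
  have "a \<in> P \<or> 1 - a \<in> P" for a
  proof (rule ccontr)
    assume "\<not> ?thesis"
    then obtain p x q y where px: "g = p + a * x" "p \<in> P" and qy: "g = q + (1 - a) * y" "q \<in> P"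
      using ext by meson
    \<comment> \<open>One factor \<open>g\<close> is replaced by each expression; commutators are
      kept explicit so that every summand visibly lies in \<open>P\<close>.\<close>
    have "g * g = p * g + a * x * q + a * (x * (1 - a) - (1 - a) * x) * y - (a * a - a) * x * y"
    proof -
      have "g * g = p * g + a * x * g"
        using px(1) by (metis distrib_right)
      also have "a * x * g = a * x * q + a * x * ((1 - a) * y)"
        using qy(1) by (metis distrib_left)
      finally show ?thesis
        by (simp add: algebra_simps)
    qed
    moreover have "p * g + a * x * q + a * (x * (1 - a) - (1 - a) * x) * y - (a * a - a) * x * y \<in> P"
      using PI(2) comm bool
      by (intro P_diff[OF P_add[OF P_add[OF P_right P_left] P_right[OF P_left]] P_right[OF P_right]]
          px(2) qy(2)) blast+
    ultimately have "g * g - (g * g - g) \<in> P"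
      using bool[of g] PI(2) P_diff by (metis subsetD)
    then show False
      using PI(3) by simp
  qed
  then show ?thesis
    using that PI by blast
qed

definition char_map :: "'a::ring_1 set \<Rightarrow> 'a \<Rightarrow> bit"
  where "char_map P a = (if a \<in> P then 0 else 1)"

text \<open>By the dichotomy the quotient by \<open>P\<close> has only the classes of
  \<open>0\<close> and \<open>1\<close>, so \<open>char_map P\<close> is the quotient map onto the
  field with two elements.\<close>

lemma char_map_hom:
  fixes P :: "'a::ring_1 set"
  assumes P: "type_ideal P" "1 \<notin> P" and two: "\<And>a. a \<in> P \<or> 1 - a \<in> P"
  shows "char_map P (a + b) = char_map P a + char_map P b"
    and "char_map P (a * b) = char_map P a * char_map P b"
    and "char_map P 1 = 1"
proof -
  note P_add = type_ideal_add[OF P(1)] and P_left = type_ideal_left[OF P(1)]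
    and P_right = type_ideal_right[OF P(1)] and P_diff = type_ideal_diff[OF P(1)]
  have "(1::'a) + 1 \<in> P"
    using two[of "1 + 1"] P(2) type_ideal_minus[OF P(1), of "-1"] by auto
  have add1: "a + b \<in> P" if "a \<notin> P" "b \<notin> P" for a b
  proof -
    have "(1 + 1) - ((1 - a) + (1 - b)) \<in> P"
      using that two \<open>1 + 1 \<in> P\<close> P_add P_diff by blast
    then show ?thesis by (simp add: algebra_simps)
  qed
  have add2: "a + b \<notin> P" "b + a \<notin> P" if "a \<in> P" "b \<notin> P" for a b
    using that P_diff[of "a + b" a] P_diff[of "b + a" a] by auto
  have mult: "a * b \<notin> P" if "a \<notin> P" "b \<notin> P" for a b
  proof
    assume "a * b \<in> P"
    moreover have "1 - a \<in> P" "1 - b \<in> P"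
      using that two by auto
    ultimately have "(1 - a) + a * (1 - b) + a * b \<in> P"
      using P_add P_left by blast
    then show False using P(2) by (simp add: algebra_simps)
  qed
  show "char_map P (a + b) = char_map P a + char_map P b"
    using P_add[of a b] add1[of a b] add2 by (auto simp: char_map_def)
  show "char_map P (a * b) = char_map P a * char_map P b"
    using P_left[of b a] P_right[of a b] mult[of a b] by (auto simp: char_map_def)
  show "char_map P 1 = 1"
    using P(2) by (simp add: char_map_def)
qed

text \<open>Choose a prime ideal avoiding each \<open>g\<close>. Orthogonality forces its character
  to kill the other two, so the three characters together send the \<open>g\<close>s to the standard
  basis. The factor is taken by the kernel of this map, which may be larger than
  \<open>I\<close>.\<close>

lemma has_factor_F2_cubedI:
  fixes I :: "'a::ring_1 set"
  assumes I: "type_ideal I" and comm: "\<And>x y. x * y - y * x \<in> I" and bool: "\<And>x. x * x - x \<in> I"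
    and g: "g1 \<notin> I" "g2 \<notin> I" "g3 \<notin> I"
    and orth: "g1 * g2 \<in> I" "g1 * g3 \<in> I" "g2 * g3 \<in> I"
  shows "has_factor_F2_cubed TYPE('a)"
proof -
  define Ch where "Ch g P \<longleftrightarrow> type_ideal P \<and> I \<subseteq> P \<and> g \<notin> P \<and> (\<forall>a. a \<in> P \<or> 1 - a \<in> P)" for g P
  obtain P1 P2 P3 where Ch: "Ch g1 P1" "Ch g2 P2" "Ch g3 P3"
    unfolding Ch_def using boolean_prime_ideal[OF I comm bool] g by metis
  have one: "1 \<notin> P" if "Ch g P" for g P
    using that type_ideal_left[of P 1 g] by (auto simp: Ch_def)
  note hom = char_map_hom[OF _ one]
  have orth': "g2 * g1 \<in> I" "g3 * g1 \<in> I" "g3 * g2 \<in> I"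
    using orth comm[of g2 g1] comm[of g3 g1] comm[of g3 g2] type_ideal_add[OF I]
    by (metis diff_add_cancel)+
  have val: "char_map P g = 1" if "Ch g P" for g P
    using that by (simp add: Ch_def char_map_def)
  have val0: "char_map P g' = 0" if "Ch g P" "g * g' \<in> I" for g g' P
  proof -
    have "char_map P (g * g') = char_map P g * char_map P g'"
      using that(1) by (intro hom(2)) (auto simp: Ch_def)
    moreover have "char_map P (g * g') = 0"
      using that by (auto simp: Ch_def char_map_def)
    ultimately show ?thesis
      using val[OF that(1)] by simp
  qed
  define h where "h a = (char_map P1 a, char_map P2 a, char_map P3 a)" for a
  have F2: "ring F2"
    unfolding F2_def by (rule ring_ring_of_type_algebra)
  have ringF: "ring F2_cubed"
    unfolding F2_cubed_def by (intro RDirProd_ring F2)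
  have add: "char_map P (a + b) = char_map P a + char_map P b"
    and mult: "char_map P (a * b) = char_map P a * char_map P b"
    and one1: "char_map P 1 = 1" if "Ch g P" for g P a b
    using that hom by (auto simp: Ch_def)
  interpret h: ring_hom_ring "ring_of_type_algebra :: 'a ring" F2_cubed h
  proof (rule ring_hom_ringI[OF ring_ring_of_type_algebra ringF])
  qed (simp_all add: h_def F2_cubed_def F2_def ring_of_type_algebra_def RDirProd_def DirProd_def
      monoid.defs add[OF Ch(1)] add[OF Ch(2)] add[OF Ch(3)] mult[OF Ch(1)] mult[OF Ch(2)] mult[OF Ch(3)]
      one1[OF Ch(1)] one1[OF Ch(2)] one1[OF Ch(3)] del: add_bit_eq_xor mult_bit_eq_and)
  have gen: "h g1 = (1, 0, 0)" "h g2 = (0, 1, 0)" "h g3 = (0, 0, 1)"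
    using val[OF Ch(1)] val[OF Ch(2)] val[OF Ch(3)] val0[OF Ch(1)] val0[OF Ch(2)] val0[OF Ch(3)]
      orth orth' by (simp_all add: h_def)
  have "range h = UNIV"
  proof (rule UNIV_eq_I[symmetric])
    fix x :: "bit \<times> bit \<times> bit"
    obtain i j k where x: "x = (i, j, k)"
      by (cases x)
    define pick :: "bit \<Rightarrow> 'a \<Rightarrow> 'a" where "pick b g = (if b = 1 then g else 0)" for b g
    have zero: "char_map P1 0 = 0" "char_map P2 0 = 0" "char_map P3 0 = 0"
      using Ch type_ideal_zero by (auto simp: Ch_def char_map_def)
    have "h (pick i g1 + pick j g2 + pick k g3) = (i, j, k)"
      using gen by (cases i; cases j; cases k)
        (simp_all add: h_def pick_def zero add[OF Ch(1)] add[OF Ch(2)] add[OF Ch(3)])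
    then show "x \<in> range h"
      unfolding x by (metis rangeI)
  qed
  then have "h ` carrier (ring_of_type_algebra :: 'a ring) = carrier F2_cubed"
    by (simp add: F2_cubed_def F2_def ring_of_type_algebra_def RDirProd_carrier)
  then show ?thesis
    unfolding has_factor_F2_cubed_def using h.FactRing_iso h.kernel_is_ideal by blast
qed

section \<open>Kernels of functionals without unit zeros\<close>

context functional_nonzero_on_units
begin

section \<open>Fields with a scalar other than \<open>0\<close> and \<open>1\<close>\<close>

lemma scale_unit:
  assumes "u \<in> type_units" "t \<noteq> 0"
  shows "t *s u \<in> type_units"
proof -
  obtain v where "u * v = 1" "v * u = 1"
    using assms(1) type_units_iff by blast
  then show ?thesis
    using assms(2) by (intro type_unitsI[of _ "inverse t *s v"]) (simp_all add: scale_mult_left scale_mult_right)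
qed

text \<open>Write \<open>a\<close> as \<open>u * g\<close> modulo \<open>core\<close>. Gluing
  \<open>u\<close> on \<open>g\<close> with \<open>u\<close>, respectively \<open>t *s u\<close>, on
  \<open>1 - g\<close> gives two linear equations for \<open>f (u * g * e)\<close> and
  \<open>f (u * (1 - g) * e)\<close>; as \<open>t \<noteq> 1\<close>, both vanish. Centrality of
  \<open>e\<close> modulo \<open>core\<close> handles right factors.\<close>

lemma idempotent_in_coreI:
  assumes t: "t \<noteq> 0" "t \<noteq> (1::'f)" and e: "e * e = e" and fe: "\<And>u. u \<in> type_units \<Longrightarrow> f (u * e) = 0"
  shows "e \<in> core"
proof -
  have right: "f (a * e) = 0" for a
  proof -
    obtain u g where u: "u \<in> type_units" "g * g = g" "a - u * g \<in> core"
      using unit_idempotent_mod_core .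
    obtain w where w: "w \<in> type_units" "u * g + (t *s u) * (1 - g) - w \<in> core"
      using glue_units[OF u(1) scale_unit[OF u(1) t(1)] u(2)] .
    have "f ((u * g + (t *s u) * (1 - g)) * e) = f (w * e)"
      using core_right[OF w(2), of e] by (intro f_cong) (simp add: left_diff_distrib)
    then have 1: "f (u * g * e) + t * f (u * (1 - g) * e) = 0"
      using fe[OF w(1)] by (simp add: distrib_right f_add scale_mult_left f_scale)
    have "f (u * g * e) + f (u * (1 - g) * e) = f (u * e)"
      by (simp add: algebra_simps f_diff)
    then have 2: "f (u * g * e) + f (u * (1 - g) * e) = 0"
      using fe[OF u(1)] by simp
    then have "f (u * g * e) = - f (u * (1 - g) * e)"
      by (simp add: eq_neg_iff_add_eq_0)
    with 1 have "(t - 1) * f (u * (1 - g) * e) = 0"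
      by (simp add: algebra_simps)
    with t 2 have "f (u * g * e) = 0"
      by simp
    moreover have "f (a * e) = f (u * g * e)"
      using core_right[OF u(3), of e] by (intro f_cong) (simp add: left_diff_distrib)
    ultimately show ?thesis by simp
  qed
  have "f (x * e * y) = 0" for x y
  proof -
    have "x * (e * y - y * e) \<in> core"
      using core_left idempotent_central[OF e] .
    then have "f (x * e * y) = f (x * y * e)"
      by (intro f_cong) (simp add: algebra_simps)
    then show ?thesis using right by simp
  qed
  then show ?thesis by (simp add: core_def)
qed

text \<open>If \<open>f (v * e)\<close> and \<open>f (w * (1 - e))\<close> were both nonzero,
  rescaling \<open>w\<close> would make \<open>f\<close> vanish on a glued unit. So \<open>e\<close>
  or \<open>1 - e\<close> lies in \<open>core\<close>; in the second case \<open>x\<close> is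
  congruent to a unit, contradicting \<open>f x = 0\<close>.\<close>

lemma kernel_subset_core_large_field:
  assumes t: "t \<noteq> 0" "t \<noteq> (1::'f)" and x: "f x = 0"
  shows "x \<in> core"
proof -
  obtain u e where u: "u \<in> type_units" "e * e = e" "x - u * e \<in> core"
    using unit_idempotent_mod_core .
  have "f (v * e) = 0 \<or> f (w * (1 - e)) = 0" if v: "v \<in> type_units" and w: "w \<in> type_units" for v w
  proof (rule ccontr)
    assume nz: "\<not> ?thesis"
    define s where "s = - f (v * e) / f (w * (1 - e))"
    have "s *s w \<in> type_units"
      using nz by (intro scale_unit w) (simp add: s_def)
    then have "f (v * e) + s * f (w * (1 - e)) \<noteq> 0"
      using f_glue[OF v _ u(2)] by (metis scale_mult_left f_scale)
    then show False
      using nz by (simp add: s_def)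
  qed
  then consider "\<And>v. v \<in> type_units \<Longrightarrow> f (v * e) = 0" | "\<And>w. w \<in> type_units \<Longrightarrow> f (w * (1 - e)) = 0"
    by blast
  then show ?thesis
  proof cases
    case 1
    then have "e \<in> core"
      using idempotent_in_coreI[OF t u(2)] by blast
    then have "(x - u * e) + u * e \<in> core"
      using u(3) core_add core_left by blast
    then show ?thesis by simp
  next
    case 2
    then have "1 - e \<in> core"
      using idempotent_in_coreI[OF t idempotent_compl_zero(3)[OF u(2)]] by blast
    then have "(x - u * e) - u * (1 - e) \<in> core"
      using u(3) core_diff core_left by blast
    then have "f x = f u"
      by (intro f_cong) (simp add: algebra_simps)
    then show ?thesis
      using f_unit[OF u(1)] x by simp
  qed
qed

section \<open>The field with two elements: the quotient by \<open>core\<close> is Boolean\<close>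

context
  assumes F2: "\<And>c::'f. c = 0 \<or> c = 1"
begin

text \<open>Nonzero values of \<open>f\<close> are \<open>1\<close>, so gluing \<open>v\<close> or
  \<open>1\<close> on \<open>e\<close> with \<open>1\<close> on \<open>1 - e\<close> yields the same
  value and \<open>f (v * e) = f e\<close>. Every \<open>a\<close> is a unit times an idempotent
  modulo \<open>core\<close>.\<close>

lemma f_unit_mult_left:
  assumes u: "u \<in> type_units"
  shows "f (u * a) = f a"
proof -
  have *: "f (v * e) = f e" if v: "v \<in> type_units" and e: "e * e = e" for v e
  proof -
    have "f (v * e) + f (1 - e) = 1"
      using F2 f_glue[OF v one_in_type_units e] by fastforce
    moreover have "f e + f (1 - e) = 1"
      using F2 f_glue[OF one_in_type_units one_in_type_units e] by fastforce
    ultimately show ?thesis by (metis add_right_cancel)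
  qed
  obtain v e where v: "v \<in> type_units" "e * e = e" "a - v * e \<in> core"
    using unit_idempotent_mod_core .
  have "u * (a - v * e) \<in> core"
    using v(3) core_left by blast
  then have "f (u * a) = f (u * v * e)"
    by (intro f_cong) (simp add: algebra_simps)
  then show ?thesis
    using *[OF mult_in_type_units[OF u v(1)] v(2)] *[OF v(1,2)] f_cong[OF v(3)] by simp
qed

text \<open>Writing \<open>x\<close> as \<open>w * e\<close> modulo \<open>core\<close> and moving
  \<open>e\<close> past \<open>u\<close> puts the units \<open>w * u\<close> on the far left, where
  \<open>f\<close> ignores them.\<close>

lemma unit_cong_one:
  assumes u: "u \<in> type_units"
  shows "u - 1 \<in> core"
proof -
  have "f (x * (u - 1) * y) = 0" for x y
  proof -
    obtain w e where w: "w \<in> type_units" "e * e = e" "x - w * e \<in> core"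
      using unit_idempotent_mod_core .
    have "(x - w * e) * (u * y) + w * (e * u - u * e) * y \<in> core"
      using w core_add core_left core_right idempotent_central by blast
    then have "f (x * u * y) = f (w * u * (e * y))"
      by (intro f_cong) (simp add: algebra_simps)
    moreover have "(x - w * e) * y \<in> core"
      using w core_right by blast
    then have "f (x * y) = f (w * (e * y))"
      by (intro f_cong) (simp add: algebra_simps)
    ultimately have "f (x * u * y) = f (x * y)"
      using f_unit_mult_left w(1) u mult_in_type_units by metis
    then show ?thesis
      by (simp add: algebra_simps f_diff)
  qed
  then show ?thesis by (simp add: core_def)
qed

lemma idempotent_mod_core:
  obtains e where "e * e = e" "a - e \<in> core"
proof -
  obtain v e where v: "v \<in> type_units" "e * e = e" "a - v * e \<in> core"
    using unit_idempotent_mod_core .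
  have "(a - v * e) + (v - 1) * e \<in> core"
    using v unit_cong_one core_add core_right by blast
  then have "a - e \<in> core"
    by (simp add: algebra_simps)
  then show ?thesis using that v by blast
qed

lemma commute_mod_core: "x * y - y * x \<in> core"
proof -
  obtain e where e: "e * e = e" "x - e \<in> core"
    using idempotent_mod_core .
  have "(x - e) * y - y * (x - e) + (e * y - y * e) \<in> core"
    by (rule core_add[OF core_diff[OF core_right[OF e(2)] core_left[OF e(2)]] idempotent_central[OF e(1)]])
  then show ?thesis by (simp add: algebra_simps)
qed

lemma boolean_mod_core: "x * x - x \<in> core"
proof -
  obtain e where e: "e * e = e" "x - e \<in> core"
    using idempotent_mod_core .
  have "(x - e) * x + e * (x - e) - (x - e) \<in> core"
    by (rule core_diff[OF core_add[OF core_right[OF e(2)] core_left[OF e(2)]] e(2)])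
  then show ?thesis using e(1) by (simp add: algebra_simps)
qed

text \<open>Some \<open>b\<close> has \<open>f (a * b) \<noteq> 0\<close>. The elements
  \<open>a * b\<close>, \<open>a * (1 - b)\<close> and \<open>1 - a\<close> sum to \<open>1\<close>,
  are orthogonal modulo \<open>core\<close>, and \<open>f\<close> vanishes on none of them because
  \<open>f a = 0\<close>.\<close>

lemma has_factor_F2_cubed_if_kernel_not_core:
  assumes a: "f a = 0" "a \<notin> core"
  shows "has_factor_F2_cubed TYPE('a)"
proof -
  obtain p q where pq: "f (p * a * q) \<noteq> 0"
    using a(2) unfolding core_def by blast
  define b where "b = p * q"
  have "(p * a - a * p) * q \<in> core"
    using core_right commute_mod_core .
  then have "f (p * a * q) = f (a * b)"
    by (intro f_cong) (simp add: b_def algebra_simps)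
  with pq have ab: "f (a * b) \<noteq> 0" by simp
  have bool: "a * (1 - a) \<in> core"
    using core_minus[OF boolean_mod_core[of a]] by (simp add: algebra_simps)
  have "a * (1 - b) \<notin> core"
    using f_core[of "a * (1 - b)"] ab a(1) by (auto simp: algebra_simps f_diff)
  moreover have "a * b \<notin> core"
    using ab f_core by blast
  moreover have "1 - a \<notin> core"
    using f_core[of "1 - a"] f_unit[OF one_in_type_units] a(1) by (auto simp: f_diff)
  moreover have "a * b * (a * (1 - b)) \<in> core"
  proof -
    have "a * (b * a - a * b) * (1 - b) - a * a * (b * b - b) \<in> core"
      by (intro core_diff core_left core_right commute_mod_core boolean_mod_core)
    then show ?thesis by (simp add: algebra_simps)
  qed
  \<comment> \<open>Used with \<open>c = b\<close> and \<open>c = 1 - b\<close> for the two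
    remaining orthogonality relations.\<close>
  moreover have "a * c * (1 - a) \<in> core" for c
  proof -
    have "a * (c * (1 - a) - (1 - a) * c) + a * (1 - a) * c \<in> core"
      by (rule core_add[OF core_left[OF commute_mod_core] core_right[OF bool]])
    then show ?thesis by (simp add: algebra_simps)
  qed
  ultimately show ?thesis
    using has_factor_F2_cubedI[OF core_ideal commute_mod_core boolean_mod_core,
        of "a * b" "a * (1 - b)" "1 - a"] by blast
qed

end

end

theorem theorem2:
  fixes scale :: "'f::field \<Rightarrow> 'a::ring_1 \<Rightarrow> 'a"
    and H :: "'a set"
  assumes "finite_dimensional_algebra scale"
    and "module.subspace scale H"
    and "vector_space.dim scale (UNIV :: 'a set) = vector_space.dim scale H + 1"
    and "\<not> ideal H (ring_of_type_algebra :: 'a ring)"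
    and "\<not> (CARD('f) = 2 \<and> has_factor_F2_cubed TYPE('a))"
  shows "H \<inter> Units (ring_of_type_algebra :: 'a ring) \<noteq> {}"
proof
  assume disjoint: "H \<inter> type_units = {}"
  interpret finite_dimensional_algebra scale by fact
  obtain f :: "'a \<Rightarrow> 'f" where f: "\<And>x y. f (x + y) = f x + f y" "\<And>c x. f (scale c x) = c * f x"
    "\<And>x. x \<in> H \<longleftrightarrow> f x = 0"
    using hyperplane_functional[OF assms(2,3)] by metis
  interpret functional_nonzero_on_units scale f
    using f disjoint by unfold_locales auto
  \<comment> \<open>\<open>core\<close> is an ideal inside \<open>H\<close> and \<open>H\<close> is
    not an ideal, so the inclusion is strict.\<close>
  have "core \<noteq> H"
    using core_ideal assms(4) by blast
  then obtain a where a: "f a = 0" "a \<notin> core"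
    using f(3) f_core by blast
  have "t = 0 \<or> t = 1" for t :: 'f
    using kernel_subset_core_large_field a by blast
  moreover from this have "(UNIV :: 'f set) = {0, 1}"
    by blast
  then have "CARD('f) = 2"
    by (metis card_2_iff zero_neq_one)
  ultimately show False
    using has_factor_F2_cubed_if_kernel_not_core a assms(5) by blast
qed

end
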